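(* The maximizer of the likelihood functional $$\ell(f)=\sum_{i=1}^d\log\left(\frac{c}{2}f(s_i)^2\right)-\frac12\|f\|_{R_\infty}^2$$ has the form $$f(s)=\sum_{i=1}^d\alpha_i\,r_\infty(s,s_i)$$ for some real coefficients $\alpha_1,\dots,\alpha_d$, where $$r_\infty(s,t)=r_0(s,t)+\sum_{i,j=1}^p(S^{-1})_{ij}\,a_i(s)a_j(t).$$
   Context: Let $c,\gamma$ be positive real constants. Let $\Omega$ be a compact domain equipped with a finite measure $\mu$, let $\mathcal{L}^2(\Omega)=\mathcal{L}^2(\Omega,\mu)$, with inner product $\langle\cdot,\cdot\rangle$, and let $s_1,\dots,s_d\in\Omega$ be the observed points of a point process on $\Omega$. Let $k:\Omega\times\Omega\to\mathbb{R}$ be a continuous, symmetric and positive-definite kernel with associated integral operator $Kf(s)=\int_\Omega k(s,t)f(t)\,d\mu(t)$; the operator $K:\mathcal{L}^2(\Omega)\to C(\Omega)$ is bounded, self-adjoint and positive. Let $x_1,\dots,x_p\in C(\Omega)$ be linearly independent, and let $X\beta=\sum_{j=1}^p\beta_jx_j$ for $\beta\in\mathbb{R}^p$; equivalently, $X:\mathbb{R}^p\to C(\Omega)$ is injective. It is not required that $\mathrm{span}\{x_1,\dots,x_p\}\subset\mathcal{H}_K$ or that $\mathrm{span}\{x_1,\dots,x_p\}\cap\mathcal{H}_K=\{0\}$, where $\mathcal{H}_K$ is the reproducing kernel Hilbert space (RKHS) of $k$. The adjoint is $X^*h=(\langle h,x_j\rangle)_{j=1}^p$ for $h\in\mathcal{L}^2(\Omega)$.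 Set $A=cK+\gamma I$, where $I$ is the identity, $S=X^*A^{-1}X$ (a $p\times p$ matrix), and $a_i=A^{-1}x_i$. Let $r_0$ be the kernel function of the operator $R_0=K(cK+\gamma I)^{-1}$. Let $$R_\infty=\frac{1}{c}\left(I-\gamma\left(A^{-1}-A^{-1}XS^{-1}X^*A^{-1}\right)\right).$$ The function $r_\infty$ displayed in the claim is taken as the kernel function of $R_\infty$; $\mathcal{H}_{R_\infty}$ is the RKHS with kernel operator $R_\infty$, and $\|\cdot\|_{R_\infty}$ is its norm.
   Formalization: The operator formula for R_∞ has kernel r_0 + (γ/c)Σ(S^{-1})_{ij} a_i a_j, which differs from the displayed r_∞ unless γ = c; the formal theorem takes the norm to be that of the RKHS whose reproducing kernel is the displayed r_∞. *)

theory Defs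
  imports "HOL-Analysis.Analysis"
begin

section \<open>Square-integrable functions and the operator $A = cK + \gamma I$\<close>

text \<open>
  Elements of \<open>L2 M\<close> are functions, not classes modulo null sets. This is harmless for the
  inverse of $A$: the equation $c K u + \gamma u = h$, required at every point of the space, has
  exactly one solution $u$ for each square-integrable function $h$, because $K u$ depends only on
  the class of $u$ and so $u = (h - c K u) / \gamma$ is determined pointwise. The class of $u$ is
  the image of the class of $h$ under the inverse on classes, and if $h$ is continuous then $u$ is
  the continuous representative.
\<close>

definition L2 :: "'a measure \<Rightarrow> ('a \<Rightarrow> real) set" where
  "L2 M = {f \<in> borel_measurable M \<inter> extensional (space M). integrable M (\<lambda>s. (f s)\<^sup>2)}"

definition L2_inner :: "'a measure \<Rightarrow> ('a \<Rightarrow> real) \<Rightarrow> ('a \<Rightarrow> real) \<Rightarrow> real" where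
  "L2_inner M f g = (\<integral>s. f s * g s \<partial>M)"

definition integral_op ::
  "'a measure \<Rightarrow> ('a \<Rightarrow> 'a \<Rightarrow> real) \<Rightarrow> ('a \<Rightarrow> real) \<Rightarrow> ('a \<Rightarrow> real)" where
  "integral_op M k f = (\<lambda>s\<in>space M. \<integral>t. k s t * f t \<partial>M)"

definition reg_op ::
  "'a measure \<Rightarrow> ('a \<Rightarrow> 'a \<Rightarrow> real) \<Rightarrow> real \<Rightarrow> real \<Rightarrow> ('a \<Rightarrow> real) \<Rightarrow> ('a \<Rightarrow> real)" where
  "reg_op M k c \<gamma> f = (\<lambda>s\<in>space M. c * integral_op M k f s + \<gamma> * f s)"

definition reg_inv ::
  "'a measure \<Rightarrow> ('a \<Rightarrow> 'a \<Rightarrow> real) \<Rightarrow> real \<Rightarrow> real \<Rightarrow> ('a \<Rightarrow> real) \<Rightarrow> ('a \<Rightarrow> real)" where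
  "reg_inv M k c \<gamma> = inv_into (L2 M) (reg_op M k c \<gamma>)"

definition R0_op ::
  "'a measure \<Rightarrow> ('a \<Rightarrow> 'a \<Rightarrow> real) \<Rightarrow> real \<Rightarrow> real \<Rightarrow> ('a \<Rightarrow> real) \<Rightarrow> ('a \<Rightarrow> real)" where
  "R0_op M k c \<gamma> f = integral_op M k (reg_inv M k c \<gamma> f)"

text \<open>
  Continuity is what makes the kernel function of an operator unique (when nonempty open sets have
  positive measure); without it the values at individual points would be arbitrary.
\<close>

definition is_kernel_function ::
  "'a::topological_space measure \<Rightarrow> ('a \<Rightarrow> 'a \<Rightarrow> real) \<Rightarrow> (('a \<Rightarrow> real) \<Rightarrow> ('a \<Rightarrow> real)) \<Rightarrow> bool" where
  "is_kernel_function M r R \<longleftrightarrow>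
     continuous_on (space M \<times> space M) (\<lambda>(s, t). r s t) \<and>
     (\<forall>f\<in>L2 M. \<forall>s\<in>space M. R f s = (\<integral>t. r s t * f t \<partial>M))"


section \<open>The covariates and the kernel function $r_\infty$\<close>

definition design_op ::
  "'a measure \<Rightarrow> ('p::finite \<Rightarrow> 'a \<Rightarrow> real) \<Rightarrow> real^'p \<Rightarrow> ('a \<Rightarrow> real)" where
  "design_op M x \<beta> = (\<lambda>s\<in>space M. \<Sum>j\<in>UNIV. \<beta> $ j * x j s)"

definition design_adj ::
  "'a measure \<Rightarrow> ('p::finite \<Rightarrow> 'a \<Rightarrow> real) \<Rightarrow> ('a \<Rightarrow> real) \<Rightarrow> real^'p" where
  "design_adj M x h = (\<chi> j. L2_inner M h (x j))"

definition S_mat ::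
  "'a measure \<Rightarrow> ('a \<Rightarrow> 'a \<Rightarrow> real) \<Rightarrow> real \<Rightarrow> real \<Rightarrow> ('p::finite \<Rightarrow> 'a \<Rightarrow> real) \<Rightarrow> real^'p^'p" where
  "S_mat M k c \<gamma> x = matrix (\<lambda>\<beta>. design_adj M x (reg_inv M k c \<gamma> (design_op M x \<beta>)))"

definition a_fun ::
  "'a measure \<Rightarrow> ('a \<Rightarrow> 'a \<Rightarrow> real) \<Rightarrow> real \<Rightarrow> real \<Rightarrow> ('p::finite \<Rightarrow> 'a \<Rightarrow> real) \<Rightarrow> 'p \<Rightarrow> 'a \<Rightarrow> real" where
  "a_fun M k c \<gamma> x i = reg_inv M k c \<gamma> (restrict (x i) (space M))"

text \<open>
  The integral kernel of the operator
  $R_\infty = \frac1c (I - \gamma (A^{-1} - A^{-1} X S^{-1} X^* A^{-1}))$ works out as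
  $r_0(s,t) + \frac{\gamma}{c} \sum_{i,j} (S^{-1})_{ij} a_i(s) a_j(t)$. The function below does not
  have the factor $\gamma / c$; it is the function that is used as the kernel of the space
  $\mathcal{H}_{R_\infty}$.
\<close>

definition r_inf ::
  "'a measure \<Rightarrow> ('a \<Rightarrow> 'a \<Rightarrow> real) \<Rightarrow> real \<Rightarrow> real \<Rightarrow> ('p::finite \<Rightarrow> 'a \<Rightarrow> real) \<Rightarrow>
   ('a \<Rightarrow> 'a \<Rightarrow> real) \<Rightarrow> 'a \<Rightarrow> 'a \<Rightarrow> real" where
  "r_inf M k c \<gamma> x r0 s t =
     r0 s t + (\<Sum>i\<in>UNIV. \<Sum>j\<in>UNIV.
       matrix_inv (S_mat M k c \<gamma> x) $ i $ j * a_fun M k c \<gamma> x i s * a_fun M k c \<gamma> x j t)"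


section \<open>Positive-definite kernels and reproducing kernel Hilbert spaces\<close>

definition symmetric_kernel :: "'a set \<Rightarrow> ('a \<Rightarrow> 'a \<Rightarrow> real) \<Rightarrow> bool" where
  "symmetric_kernel \<Omega> k \<longleftrightarrow> (\<forall>s\<in>\<Omega>. \<forall>t\<in>\<Omega>. k s t = k t s)"

definition positive_definite_kernel :: "'a set \<Rightarrow> ('a \<Rightarrow> 'a \<Rightarrow> real) \<Rightarrow> bool" where
  "positive_definite_kernel \<Omega> k \<longleftrightarrow>
     (\<forall>F (w :: 'a \<Rightarrow> real). finite F \<and> F \<subseteq> \<Omega> \<longrightarrow> 0 \<le> (\<Sum>s\<in>F. \<Sum>t\<in>F. w s * w t * k s t))"

text \<open>
  A function on \<open>\<Omega>\<close> is represented by a total function that is \<open>undefined\<close> outside \<open>\<Omega>\<close>, so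
  that equality on \<open>\<Omega>\<close> is equality.
\<close>

definition rkhs_norm :: "(('a \<Rightarrow> real) \<Rightarrow> ('a \<Rightarrow> real) \<Rightarrow> real) \<Rightarrow> ('a \<Rightarrow> real) \<Rightarrow> real" where
  "rkhs_norm ip f = sqrt (ip f f)"

definition function_inner_space ::
  "'a set \<Rightarrow> ('a \<Rightarrow> real) set \<Rightarrow> (('a \<Rightarrow> real) \<Rightarrow> ('a \<Rightarrow> real) \<Rightarrow> real) \<Rightarrow> bool" where
  "function_inner_space \<Omega> H ip \<longleftrightarrow>
     H \<subseteq> extensional \<Omega> \<and>
     (\<lambda>s\<in>\<Omega>. 0) \<in> H \<and>
     (\<forall>f\<in>H. \<forall>g\<in>H. (\<lambda>s\<in>\<Omega>. f s + g s) \<in> H) \<and>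
     (\<forall>f\<in>H. \<forall>b. (\<lambda>s\<in>\<Omega>. b * f s) \<in> H) \<and>
     (\<forall>f\<in>H. \<forall>g\<in>H. ip f g = ip g f) \<and>
     (\<forall>f\<in>H. \<forall>g\<in>H. \<forall>h\<in>H. ip (\<lambda>s\<in>\<Omega>. f s + g s) h = ip f h + ip g h) \<and>
     (\<forall>f\<in>H. \<forall>h\<in>H. \<forall>b. ip (\<lambda>s\<in>\<Omega>. b * f s) h = b * ip f h) \<and>
     (\<forall>f\<in>H. 0 \<le> ip f f) \<and>
     (\<forall>f\<in>H. ip f f = 0 \<longrightarrow> f = (\<lambda>s\<in>\<Omega>. 0))"

definition is_rkhs ::
  "'a set \<Rightarrow> ('a \<Rightarrow> 'a \<Rightarrow> real) \<Rightarrow> ('a \<Rightarrow> real) set \<Rightarrow>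
   (('a \<Rightarrow> real) \<Rightarrow> ('a \<Rightarrow> real) \<Rightarrow> real) \<Rightarrow> bool" where
  "is_rkhs \<Omega> r H ip \<longleftrightarrow>
     function_inner_space \<Omega> H ip \<and>
     Metric_space.mcomplete H (\<lambda>f g. rkhs_norm ip (\<lambda>s\<in>\<Omega>. f s - g s)) \<and>
     (\<forall>t\<in>\<Omega>. (\<lambda>s\<in>\<Omega>. r s t) \<in> H \<and> (\<forall>f\<in>H. ip f (\<lambda>s\<in>\<Omega>. r s t) = f t))"


section \<open>The likelihood functional\<close>

text \<open>The library logarithm has \<open>ln 0 = 0\<close>; in the likelihood $\log 0 = -\infty$ is meant.\<close>

definition log_ext :: "real \<Rightarrow> ereal" where
  "log_ext u = (if 0 < u then ereal (ln u) else -\<infinity>)"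

definition log_lik ::
  "real \<Rightarrow> nat \<Rightarrow> (nat \<Rightarrow> 'a) \<Rightarrow> (('a \<Rightarrow> real) \<Rightarrow> ('a \<Rightarrow> real) \<Rightarrow> real) \<Rightarrow> ('a \<Rightarrow> real) \<Rightarrow> ereal" where
  "log_lik c d p ip f =
     (\<Sum>i=1..d. log_ext (c / 2 * (f (p i))\<^sup>2)) - ereal (1 / 2 * (rkhs_norm ip f)\<^sup>2)"

text \<open>
  A maximizer has to lie in the domain of the functional: where every function in the space
  vanishes at some observed point, the functional is constantly $-\infty$ and has no maximizer.
\<close>

definition is_maximizer :: "(('a \<Rightarrow> real) \<Rightarrow> ereal) \<Rightarrow> ('a \<Rightarrow> real) set \<Rightarrow> ('a \<Rightarrow> real) \<Rightarrow> bool" where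
  "is_maximizer l H f \<longleftrightarrow> is_arg_max l (\<lambda>g. g \<in> H) f \<and> l f \<noteq> -\<infinity>"

end

theory Submission
  imports Defs
begin

text \<open>
  This is the representer argument. Interpolate $f$ at the observed points by a combination $g$ of
  the functions $r_\infty(\cdot, s_i)$. The difference $h = f - g$ vanishes at the observed points,
  so by the reproducing property it is orthogonal to $g$, and $\|f\|^2 = \|g\|^2 + \|h\|^2$. The
  data terms of $f$ and $g$ agree, hence maximality of $f$ forces $h = 0$.
\<close>

locale reproducing_space =
  fixes \<Omega> :: "'a set"
    and r :: "'a \<Rightarrow> 'a \<Rightarrow> real"
    and H :: "('a \<Rightarrow> real) set"
    and ip :: "('a \<Rightarrow> real) \<Rightarrow> ('a \<Rightarrow> real) \<Rightarrow> real"
  assumes inner_space: "function_inner_space \<Omega> H ip"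
    and kernel_mem: "t \<in> \<Omega> \<Longrightarrow> (\<lambda>u\<in>\<Omega>. r u t) \<in> H"
    and reproducing: "t \<in> \<Omega> \<Longrightarrow> f \<in> H \<Longrightarrow> ip f (\<lambda>u\<in>\<Omega>. r u t) = f t"
begin

lemma
  shows zero_mem: "(\<lambda>u\<in>\<Omega>. 0) \<in> H"
    and add_mem: "f \<in> H \<Longrightarrow> g \<in> H \<Longrightarrow> (\<lambda>u\<in>\<Omega>. f u + g u) \<in> H"
    and scale_mem: "f \<in> H \<Longrightarrow> (\<lambda>u\<in>\<Omega>. b * f u) \<in> H"
    and ip_commute: "f \<in> H \<Longrightarrow> g \<in> H \<Longrightarrow> ip f g = ip g f"
    and ip_add: "f \<in> H \<Longrightarrow> g \<in> H \<Longrightarrow> h \<in> H \<Longrightarrow> ip (\<lambda>u\<in>\<Omega>. f u + g u) h = ip f h + ip g h"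
    and ip_scale: "f \<in> H \<Longrightarrow> h \<in> H \<Longrightarrow> ip (\<lambda>u\<in>\<Omega>. b * f u) h = b * ip f h"
    and ip_nonneg: "f \<in> H \<Longrightarrow> 0 \<le> ip f f"
    and ip_definite: "f \<in> H \<Longrightarrow> ip f f = 0 \<Longrightarrow> f = (\<lambda>u\<in>\<Omega>. 0)"
  using inner_space unfolding function_inner_space_def by blast+

lemma ip_zero:
  assumes "h \<in> H"
  shows "ip (\<lambda>u\<in>\<Omega>. 0) h = 0"
  using ip_scale[OF zero_mem assms, of 0] by simp

lemma
  assumes "f \<in> H" and "g \<in> H"
  shows diff_mem: "(\<lambda>u\<in>\<Omega>. f u - g u) \<in> H"
    and ip_diff: "h \<in> H \<Longrightarrow> ip (\<lambda>u\<in>\<Omega>. f u - g u) h = ip f h - ip g h"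
proof -
  \<comment> \<open>The axioms provide closure under sums and multiples only, so the difference
    becomes a sum with \<open>- 1 * g\<close>. The inner restriction makes the second summand
    literally the function in \<open>scale_mem\<close> and \<open>ip_scale\<close>.\<close>
  have eq: "(\<lambda>u\<in>\<Omega>. f u - g u) = (\<lambda>u\<in>\<Omega>. f u + (\<lambda>u\<in>\<Omega>. - 1 * g u) u)"
    by (rule restrict_ext) simp
  note g' = scale_mem[OF \<open>g \<in> H\<close>, of "- 1"]
  show "(\<lambda>u\<in>\<Omega>. f u - g u) \<in> H"
    unfolding eq by (rule add_mem[OF \<open>f \<in> H\<close> g'])
  show "ip (\<lambda>u\<in>\<Omega>. f u - g u) h = ip f h - ip g h" if "h \<in> H"
    unfolding eq ip_add[OF \<open>f \<in> H\<close> g' that] ip_scale[OF \<open>g \<in> H\<close> that] by simp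
qed

text \<open>Indexing by a family instead of a set of points allows repeated observations and
  induction on \<open>I\<close>. The restriction makes the sum an actual element of the extensional
  space \<open>H\<close>.\<close>

definition kernel_sum :: "'i set \<Rightarrow> ('i \<Rightarrow> 'a) \<Rightarrow> ('i \<Rightarrow> real) \<Rightarrow> 'a \<Rightarrow> real" where
  "kernel_sum I s \<alpha> = (\<lambda>u\<in>\<Omega>. \<Sum>i\<in>I. \<alpha> i * r u (s i))"

text \<open>Linearity extends the reproducing property from one kernel function to a combination.
  Consequently a function in \<open>H\<close> that vanishes at all the points is orthogonal to every
  kernel sum, which is how the lemma is used below.\<close>

lemma
  assumes "finite I" and "s ` I \<subseteq> \<Omega>"
  shows kernel_sum_mem: "kernel_sum I s \<alpha> \<in> H"
    and ip_kernel_sum: "h \<in> H \<Longrightarrow> ip (kernel_sum I s \<alpha>) h = (\<Sum>i\<in>I. \<alpha> i * h (s i))"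
proof -
  from assms have "kernel_sum I s \<alpha> \<in> H \<and>
    (\<forall>h\<in>H. ip (kernel_sum I s \<alpha>) h = (\<Sum>i\<in>I. \<alpha> i * h (s i)))"
  proof (induction I)
    case empty
    show ?case
      using zero_mem ip_zero unfolding kernel_sum_def sum.empty by blast
  next
    case (insert a I)
    define q where "q = (\<lambda>u\<in>\<Omega>. r u (s a))"
    have sa: "s a \<in> \<Omega>" using insert.prems by simp
    have q: "q \<in> H" unfolding q_def by (rule kernel_mem[OF sa])
    \<comment> \<open>\<open>reproducing\<close> has the kernel function in the second argument,
      linearity is stated for the first; symmetry bridges the two.\<close>
    have ip_q: "ip q h = h (s a)" if "h \<in> H" for h
      using reproducing[OF sa that] ip_commute[OF q that] by (simp add: q_def)
    have eq: "kernel_sum (insert a I) s \<alpha> = (\<lambda>u\<in>\<Omega>. (\<lambda>u\<in>\<Omega>. \<alpha> a * q u) u + kernel_sum I s \<alpha> u)"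
      using insert.hyps by (auto simp: kernel_sum_def q_def intro!: restrict_ext)
    note q' = scale_mem[OF q, of "\<alpha> a"]
    have IH: "kernel_sum I s \<alpha> \<in> H"
      "\<And>h. h \<in> H \<Longrightarrow> ip (kernel_sum I s \<alpha>) h = (\<Sum>i\<in>I. \<alpha> i * h (s i))"
      using insert.IH insert.prems by auto
    show ?case
    proof (intro conjI ballI)
      show "kernel_sum (insert a I) s \<alpha> \<in> H"
        unfolding eq by (rule add_mem[OF q' IH(1)])
      show "ip (kernel_sum (insert a I) s \<alpha>) h = (\<Sum>i\<in>insert a I. \<alpha> i * h (s i))" if "h \<in> H" for h
        unfolding eq ip_add[OF q' IH(1) that] ip_scale[OF q that] ip_q[OF that] IH(2)[OF that]
        using insert.hyps by simp
    qed
  qed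
  then show "kernel_sum I s \<alpha> \<in> H"
    and "h \<in> H \<Longrightarrow> ip (kernel_sum I s \<alpha>) h = (\<Sum>i\<in>I. \<alpha> i * h (s i))"
    by auto
qed

text \<open>
  The Gram matrix may be singular. In the induction step $q$ is the residual of the new kernel
  function, and $\langle q, h \rangle = h(s_a)$ whenever $h$ vanishes at the old points. With
  $h = q$ this shows that $q(s_a) = 0$ forces $q = 0$, and then no correction at $s_a$ is needed.
\<close>

lemma kernel_interpolation:
  assumes "finite I" and "s ` I \<subseteq> \<Omega>" and "f \<in> H"
  shows "\<exists>\<alpha>. \<forall>i\<in>I. kernel_sum I s \<alpha> (s i) = f (s i)"
  using assms
proof (induction I arbitrary: f)
  case empty
  then show ?case by simp
next
  case (insert a I)
  have sI: "s ` I \<subseteq> \<Omega>" and sa: "s a \<in> \<Omega>" using insert.prems by auto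
  define e where "e = (\<lambda>u\<in>\<Omega>. r u (s a))"
  have e: "e \<in> H" unfolding e_def by (rule kernel_mem[OF sa])
  obtain \<alpha> where \<alpha>: "\<And>i. i \<in> I \<Longrightarrow> kernel_sum I s \<alpha> (s i) = f (s i)"
    using insert.IH[OF sI \<open>f \<in> H\<close>] by blast
  \<comment> \<open>The new kernel function is interpolated at the old points as well; this second
    use of the induction hypothesis is the reason for generalizing over \<open>f\<close>.\<close>
  obtain \<beta> where \<beta>: "\<And>i. i \<in> I \<Longrightarrow> kernel_sum I s \<beta> (s i) = e (s i)"
    using insert.IH[OF sI e] by blast
  note mem = kernel_sum_mem[OF \<open>finite I\<close> sI]
  define q where "q = (\<lambda>u\<in>\<Omega>. e u - kernel_sum I s \<beta> u)"
  have q: "q \<in> H" unfolding q_def by (rule diff_mem[OF e mem])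
  have q_vanish: "q (s i) = 0" if "i \<in> I" for i
    using that \<beta> sI by (auto simp: q_def)
  have ip_q: "ip q h = h (s a)" if h: "h \<in> H" and vanish: "\<And>i. i \<in> I \<Longrightarrow> h (s i) = 0" for h
    using reproducing[OF sa h, folded e_def] ip_commute[OF e h] vanish
    unfolding q_def ip_diff[OF e mem h] ip_kernel_sum[OF \<open>finite I\<close> sI h] by simp
  define h where "h = (\<lambda>u\<in>\<Omega>. f u - kernel_sum I s \<alpha> u)"
  have h: "h \<in> H" unfolding h_def by (rule diff_mem[OF \<open>f \<in> H\<close> mem])
  have h_vanish: "h (s i) = 0" if "i \<in> I" for i
    using that \<alpha> sI by (auto simp: h_def)
  have h_q: "h (s a) = 0" if "q (s a) = 0"
  proof -
    have "q = (\<lambda>u\<in>\<Omega>. 0)"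
      using that ip_q[OF q q_vanish] by (intro ip_definite[OF q]) simp
    then show ?thesis using ip_q[OF h h_vanish] ip_zero[OF h] by simp
  qed
  \<comment> \<open>If \<open>q (s a) = 0\<close>, then \<open>h (s a) = 0\<close> by
    \<open>h_q\<close>, so \<open>b * q (s a) = h (s a)\<close> holds in this case too.\<close>
  define b where "b = h (s a) / q (s a)"
  have b: "b * q (s a) = h (s a)" using h_q by (auto simp: b_def)
  \<comment> \<open>These are the coefficients of \<open>kernel_sum I s \<alpha> + b * q\<close>
    after expanding \<open>q\<close> as \<open>e\<close> minus its interpolant. The term
    \<open>b * q\<close> supplies the missing value \<open>h (s a)\<close> at \<open>s a\<close> and
    changes nothing at the old points.\<close>
  define \<delta> where "\<delta> i = (if i = a then b else \<alpha> i - b * \<beta> i)" for i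
  have \<delta>: "kernel_sum (insert a I) s \<delta> u = kernel_sum I s \<alpha> u + b * q u" if "u \<in> \<Omega>" for u
  proof -
    have "(\<Sum>i\<in>I. \<delta> i * r u (s i)) = (\<Sum>i\<in>I. (\<alpha> i - b * \<beta> i) * r u (s i))"
      using insert.hyps by (intro sum.cong) (auto simp: \<delta>_def)
    then show ?thesis
      using that insert.hyps
      by (simp add: kernel_sum_def q_def e_def \<delta>_def algebra_simps sum_subtractf sum_distrib_left)
  qed
  have "kernel_sum (insert a I) s \<delta> (s i) = f (s i)" if "i \<in> insert a I" for i
  proof (cases "i = a")
    case True
    then show ?thesis using \<delta>[OF sa] b sa by (simp add: h_def)
  next
    case False
    then have "i \<in> I" using that by simp
    then show ?thesis using \<delta>[of "s i"] \<alpha> q_vanish sI by auto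
  qed
  then show ?case by blast
qed

lemma rkhs_norm_square: "f \<in> H \<Longrightarrow> (rkhs_norm ip f)\<^sup>2 = ip f f"
  by (simp add: rkhs_norm_def ip_nonneg)

lemma representer:
  assumes max: "is_maximizer (log_lik c d s ip) H f" and s: "s ` {1..d} \<subseteq> \<Omega>"
  shows "\<exists>\<alpha>. f = kernel_sum {1..d} s \<alpha>"
proof -
  have f: "f \<in> H" and finite_max: "log_lik c d s ip f \<noteq> -\<infinity>"
    and greatest: "\<And>g. g \<in> H \<Longrightarrow> \<not> log_lik c d s ip f < log_lik c d s ip g"
    using max by (auto simp: is_maximizer_def is_arg_max_def)
  obtain \<alpha> where \<alpha>: "\<And>i. i \<in> {1..d} \<Longrightarrow> kernel_sum {1..d} s \<alpha> (s i) = f (s i)"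
    using kernel_interpolation[OF finite_atLeastAtMost s f] by blast
  define g where "g = kernel_sum {1..d} s \<alpha>"
  have g: "g \<in> H" unfolding g_def by (rule kernel_sum_mem[OF _ s]) simp
  define h where "h = (\<lambda>u\<in>\<Omega>. f u - g u)"
  have h: "h \<in> H" unfolding h_def by (rule diff_mem[OF f g])
  have h_vanish: "h (s i) = 0" if "i \<in> {1..d}" for i
  proof -
    have "s i \<in> \<Omega>" using that s by blast
    then show ?thesis using \<alpha>[OF that] by (simp add: h_def g_def)
  qed
  have "ip g h = 0"
    unfolding g_def ip_kernel_sum[OF finite_atLeastAtMost s h] using h_vanish by simp
  \<comment> \<open>With \<open>h = f - g\<close> in the first argument, pairing with
    \<open>h\<close>, \<open>f\<close> and \<open>g\<close> in turn gives
    \<open>ip h h = ip f h\<close>, \<open>ip f h = ip f f - ip g f\<close> and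
    \<open>ip f g = ip g g\<close>.\<close>
  then have pythagoras: "ip f f = ip g g + ip h h"
    using ip_diff[OF f g h] ip_diff[OF f g f] ip_diff[OF f g g] ip_commute[OF f h]
      ip_commute[OF g h] ip_commute[OF f g]
    by (simp add: h_def)
  define L where "L = (\<Sum>i=1..d. log_ext (c / 2 * (f (s i))\<^sup>2))"
  \<comment> \<open>No summand is infinite from above, and the value -infinity is excluded by
    \<open>finite_max\<close>. So \<open>L\<close> is real and cancels when the two likelihoods are
    compared; with \<open>L\<close> = -infinity both would equal -infinity and the norms could not
    be compared.\<close>
  have "L \<noteq> \<infinity>"
    by (auto simp: L_def sum_Pinfty log_ext_def)
  have lf: "log_lik c d s ip f = L - ereal (ip f f / 2)"
    by (simp add: log_lik_def L_def rkhs_norm_square[OF f])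
  have lg: "log_lik c d s ip g = L - ereal (ip g g / 2)"
    using \<alpha>[folded g_def] by (simp add: log_lik_def L_def rkhs_norm_square[OF g])
  obtain l where "L = ereal l"
    using \<open>L \<noteq> \<infinity>\<close> finite_max lf by (cases L) auto
  then have "ip h h \<le> 0"
    using greatest[OF g] lf lg pythagoras by simp
  then have h_zero: "h = (\<lambda>u\<in>\<Omega>. 0)"
    using ip_nonneg[OF h] by (intro ip_definite[OF h]) simp
  have "f u = g u" if "u \<in> \<Omega>" for u
    using that fun_cong[OF h_zero, of u] by (simp add: h_def)
  moreover have "f \<in> extensional \<Omega>" "g \<in> extensional \<Omega>"
    using f g inner_space by (auto simp: function_inner_space_def)
  ultimately have "f = g" by (metis extensionalityI)
  then show ?thesis unfolding g_def by blast
qed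

end

theorem corollary2p1:
  fixes c \<gamma> :: real
    and \<Omega> :: "'a::metric_space set"
    and M :: "'a measure"
    and k r0 :: "'a \<Rightarrow> 'a \<Rightarrow> real"
    and x :: "'p::finite \<Rightarrow> 'a \<Rightarrow> real"
    and d :: nat
    and s :: "nat \<Rightarrow> 'a"
    and H :: "('a \<Rightarrow> real) set"
    and ip :: "('a \<Rightarrow> real) \<Rightarrow> ('a \<Rightarrow> real) \<Rightarrow> real"
    and f :: "'a \<Rightarrow> real"
  assumes "0 < c" and "0 < \<gamma>"
    and "compact \<Omega>"
    and "space M = \<Omega>" and "sets M = sets (restrict_space borel \<Omega>)" and "finite_measure M"
    and "\<And>i. i \<in> {1..d} \<Longrightarrow> s i \<in> \<Omega>"
    and "continuous_on (\<Omega> \<times> \<Omega>) (\<lambda>(u, v). k u v)"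
    and "symmetric_kernel \<Omega> k" and "positive_definite_kernel \<Omega> k"
    and "\<And>j. continuous_on \<Omega> (x j)" and "inj (design_op M x)"
    and "is_kernel_function M r0 (R0_op M k c \<gamma>)"
    and "is_rkhs \<Omega> (r_inf M k c \<gamma> x r0) H ip"
    and "is_maximizer (log_lik c d s ip) H f"
  shows "\<exists>\<alpha> :: nat \<Rightarrow> real. \<forall>u\<in>\<Omega>. f u = (\<Sum>i=1..d. \<alpha> i * r_inf M k c \<gamma> x r0 u (s i))"
proof -
  interpret reproducing_space \<Omega> "r_inf M k c \<gamma> x r0" H ip
    using \<open>is_rkhs \<Omega> (r_inf M k c \<gamma> x r0) H ip\<close>
    by unfold_locales (auto simp: is_rkhs_def)
  have "s ` {1..d} \<subseteq> \<Omega>"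
    using assms(7) by blast
  then obtain \<alpha> where "f = kernel_sum {1..d} s \<alpha>"
    using representer[OF \<open>is_maximizer (log_lik c d s ip) H f\<close>] by blast
  then have "\<forall>u\<in>\<Omega>. f u = (\<Sum>i=1..d. \<alpha> i * r_inf M k c \<gamma> x r0 u (s i))"
    by (simp add: kernel_sum_def)
  then show ?thesis by blast
qed

end
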